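(* Assuming (i) convexity and (ii) $L_i$-smoothness of each $f_i$, SGD, $w_{k+1}=w_k-\eta_k\nabla f_{i_k}(w_k)$, with step-size $\eta_k=\frac{1}{2L}\alpha_k$ has the following convergence rate: $$\mathbb{E}[f(\bar w_{T+1})-f(w^* )]\le\frac{2L\,\|w_1-w^*\|^2}{\sum_{k=1}^T\alpha_k}+\sigma^2\,\frac{\sum_{k=1}^T\alpha_k^2}{\sum_{k=1}^T\alpha_k},\qquad\text{where }\bar w_{T+1}=\frac{\sum_{k=1}^T\alpha_k w_k}{\sum_{k=1}^T\alpha_k}.$$ For $\alpha_k=\left[\frac{\beta}{T}\right]^{k/T}$, the convergence rate is given by $$\mathbb{E}[f(\bar w_{T+1})-f(w^* )]\le\frac{2L\,\ln(T/\beta)\,\|w_1-w^*\|^2}{\alpha T-2\beta}+\sigma^2\,\frac{T}{T-\beta}.$$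
   Context: $f:\mathbb{R}^d\to\mathbb{R}$ is $f(w)=\frac1n\sum_{i=1}^n f_i(w)$, where each $f_i$ is differentiable and has a finite minimum value $f_i^*$. $L_i$-smooth means $f_i(v)\le f_i(w)+\langle\nabla f_i(w),v-w\rangle+\frac{L_i}{2}\|v-w\|^2$ for all $v,w$. $L:=\max_i L_i$. $f$ is not assumed to be strongly convex; $w^*$ is a minimizer of $f$, and $\sigma^2:=\mathbb{E}_i[f_i(w^* )-f_i^*]$, with $\mathbb{E}_i$ the expectation over $i$ uniform in $\{1,\dots,n\}$. $T$ is the number of SGD iterations, $w_1$ is the starting point, and in iteration $k$ the index $i_k$ is selected uniformly at random from $\{1,\dots,n\}$; $\mathbb{E}$ is expectation over these random indices. $\alpha_k$ is the problem-independent part of the step-size, controlling its decay. In the second part, $\beta\ge1$ is a constant and $\alpha:=\left[\frac{\beta}{T}\right]^{1/T}\le1$.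
   Formalization: The first bound is stated for decay factors with 0 < α_k ≤ 1 (it fails for large α_k, e.g. α_1 = 10, T = 1, f quadratic); the second assumes αT > 2β, i.e. a positive denominator, without which the bound can be negative or undefined. *)

theory Defs
  imports "HOL-Probability.Probability"
begin

text \<open>
  The gradient of \<open>f\<close> at \<open>w\<close>, as the unique vector given by the library predicate \<open>gderiv\<close>;
  it is meaningful only where \<open>f\<close> is differentiable.
\<close>
definition gradient :: "('a::real_inner \<Rightarrow> real) \<Rightarrow> 'a \<Rightarrow> 'a" where
  "gradient f w = (THE D. GDERIV f w :> D)"

definition L_smooth :: "real \<Rightarrow> ('a::real_inner \<Rightarrow> real) \<Rightarrow> bool" where
  "L_smooth L f \<longleftrightarrow>
     (\<forall>v w. f v \<le> f w + inner (gradient f w) (v - w) + L / 2 * (norm (v - w))\<^sup>2)"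

definition is_minimum_value :: "('a \<Rightarrow> real) \<Rightarrow> real \<Rightarrow> bool" where
  "is_minimum_value f m \<longleftrightarrow> (\<exists>v. is_arg_min f (\<lambda>_. True) v \<and> f v = m)"

text \<open>
  SGD iterates for the step-sizes \<open>\<eta>\<close> and a realisation \<open>idx\<close> of the random index sequence.
  Iterates are numbered from 1, so \<open>sgd f \<eta> idx w1 1 = w1\<close>; the value at 0 is a dummy.
\<close>
fun sgd :: "(nat \<Rightarrow> 'a::real_inner \<Rightarrow> real) \<Rightarrow> (nat \<Rightarrow> real) \<Rightarrow> (nat \<Rightarrow> nat) \<Rightarrow> 'a \<Rightarrow> nat \<Rightarrow> 'a" where
  "sgd f \<eta> idx w1 0 = w1"
| "sgd f \<eta> idx w1 (Suc k) =
     (if k = 0 then w1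
      else sgd f \<eta> idx w1 k - \<eta> k *\<^sub>R gradient (f (idx k)) (sgd f \<eta> idx w1 k))"

definition weighted_average :: "(nat \<Rightarrow> real) \<Rightarrow> (nat \<Rightarrow> 'a::real_vector) \<Rightarrow> nat \<Rightarrow> 'a" where
  "weighted_average \<alpha> w T = (\<Sum>k=1..T. \<alpha> k *\<^sub>R w k) /\<^sub>R (\<Sum>k=1..T. \<alpha> k)"

definition iid_uniform_indices :: "'m measure \<Rightarrow> (nat \<Rightarrow> 'm \<Rightarrow> nat) \<Rightarrow> nat \<Rightarrow> nat \<Rightarrow> bool" where
  "iid_uniform_indices M I n T \<longleftrightarrow>
     prob_space.indep_vars M (\<lambda>_. count_space UNIV) I {1..T} \<and>
     (\<forall>k\<in>{1..T}. distr M (count_space UNIV) (I k) = measure_pmf (pmf_of_set {1..n}))"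

definition finite_sum :: "nat \<Rightarrow> (nat \<Rightarrow> 'a \<Rightarrow> real) \<Rightarrow> 'a \<Rightarrow> real" where
  "finite_sum n fi w = 1 / real n * (\<Sum>i=1..n. fi i w)"

end

theory Submission
  imports Defs
begin

text \<open>
  The argument follows the expected squared distance of the iterates from \<open>wstar\<close>. A single step
  along the component \<open>fi i\<close> changes this distance by an inner product, bounded through convexity by
  \<open>fi i wstar - fi i w\<close>, and by a squared gradient norm, bounded through smoothness by
  \<open>fi i w - fi_min i\<close>. The latter is split into the progress term \<open>fi i w - fi i wstar\<close> and the noise
  \<open>fi i wstar - fi_min i\<close> (\<open>gradient_step_distance\<close>).

  The index of an iteration is independent of the iterate it is applied to, so in expectation the
  progress terms average to \<open>f w - f wstar\<close> and the noise averages to \<open>\<sigma>2\<close>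
  (\<open>expectation_fresh_index\<close>, \<open>sgd_expected_step\<close>). As \<open>wstar\<close> minimises \<open>f\<close> and \<open>\<alpha> k \<le> 1\<close>, each
  iteration therefore costs at least \<open>\<alpha> k\<close> times its expected suboptimality, up to the noise
  \<open>(\<alpha> k)\<^sup>2 * \<sigma>2\<close>, out of a budget of \<open>2 * L\<close> times the initial squared distance. Summing over the
  iterations and Jensen's inequality for the weighted average give the first bound
  (\<open>sgd_weighted_average_rate\<close>).

  For the exponential step-sizes the weights form a geometric progression with ratio \<open>a\<close> and
  \<open>a ^ T = \<beta> / T\<close>. The logarithm enters through \<open>1 - a \<le> - ln a\<close>, which bounds the sum of the
  weights from below (\<open>exponential_weights\<close>); the noise factor is at most \<open>1\<close>, because weights in
  the unit interval dominate their squares, and hence at most \<open>T / (T - \<beta>)\<close>.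
\<close>

section \<open>Gradients of convex and smooth functions\<close>

text \<open>
  On a Euclidean space the derivative, a linear functional, is the inner product with a unique
  vector, so the definite description behind \<open>gradient\<close> is meaningful.
\<close>
lemma GDERIV_gradient:
  fixes f :: "'a::euclidean_space \<Rightarrow> real"
  assumes "f differentiable (at w)"
  shows "GDERIV f w :> gradient f w"
proof -
  obtain f' where f': "(f has_derivative f') (at w)"
    using assms by (auto simp: differentiable_def)
  have "linear f'"
    using f' by (rule has_derivative_linear)
  then have "f' h = inner h (adjoint f' 1)" for h
    using adjoint_works[of f' h 1] by simp
  then have "f' = (\<lambda>h. inner h (adjoint f' 1))"
    by blast
  then have ex: "GDERIV f w :> adjoint f' 1"
    using f' by (simp add: gderiv_def)
  have "D = adjoint f' 1" if "GDERIV f w :> D" for D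
  proof -
    have "(\<lambda>h. inner h D) = (\<lambda>h. inner h (adjoint f' 1))"
      using that ex unfolding gderiv_def by (rule has_derivative_unique)
    then show ?thesis
      by (metis vector_eq_ldot)
  qed
  with ex show ?thesis
    unfolding gradient_def by (rule theI)
qed

text \<open>
  Restricted to the line through \<open>w\<close> and \<open>v\<close>, the function is convex in one real variable, where
  tangents are known to lie below the graph.
\<close>
lemma convex_on_above_gradient:
  fixes f :: "'a::euclidean_space \<Rightarrow> real"
  assumes "convex_on UNIV f" and "f differentiable (at w)"
  shows "f w + inner (gradient f w) (v - w) \<le> f v"
proof -
  define \<phi> where "\<phi> t = f (w + t *\<^sub>R (v - w))" for t :: real
  have "convex_on UNIV \<phi>"
  proof (rule convex_onI)
    fix t x y :: real assume "0 < t" "t < 1"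
    have "w + ((1 - t) *\<^sub>R x + t *\<^sub>R y) *\<^sub>R (v - w)
        = (1 - t) *\<^sub>R (w + x *\<^sub>R (v - w)) + t *\<^sub>R (w + y *\<^sub>R (v - w))"
      by (simp add: algebra_simps)
    with \<open>0 < t\<close> \<open>t < 1\<close> show "\<phi> ((1 - t) *\<^sub>R x + t *\<^sub>R y) \<le> (1 - t) * \<phi> x + t * \<phi> y"
      unfolding \<phi>_def by (simp add: convex_onD[OF assms(1)])
  qed simp
  moreover have "(\<phi> has_field_derivative inner (gradient f w) (v - w)) (at 0)"
  proof -
    have "(f has_derivative (\<lambda>h. inner h (gradient f w))) (at (w + 0 *\<^sub>R (v - w)))"
      using GDERIV_gradient[OF assms(2)] by (simp add: gderiv_def)
    moreover have "((\<lambda>t. w + t *\<^sub>R (v - w)) has_derivative (\<lambda>t. t *\<^sub>R (v - w))) (at 0)"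
      by (auto intro!: derivative_eq_intros)
    ultimately have "((\<lambda>t. f (w + t *\<^sub>R (v - w))) has_derivative
        (\<lambda>t. inner (t *\<^sub>R (v - w)) (gradient f w))) (at 0)"
      by (rule has_derivative_compose[rotated])
    then show ?thesis
      by (simp add: \<phi>_def[abs_def] has_field_derivative_def inner_commute mult_commute_abs)
  qed
  ultimately have "\<phi> 1 - \<phi> 0 \<ge> inner (gradient f w) (v - w) * (1 - 0)"
    by (intro convex_on_imp_above_tangent) auto
  then show ?thesis
    by (simp add: \<phi>_def)
qed

lemma convex_on_finite_sum:
  assumes "\<And>i. i \<in> {1..n} \<Longrightarrow> convex_on UNIV (fi i)"
  shows "convex_on UNIV (finite_sum n fi)"
proof -
  have "convex_on UNIV (\<lambda>w. \<Sum>i\<in>A. fi i w)" if "finite A" "A \<subseteq> {1..n}" for A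
    using that by (induction A) (auto intro!: convex_on_add assms simp: convex_on_const)
  from this[of "{1..n}"] show ?thesis
    unfolding finite_sum_def[abs_def] by (intro convex_on_cmul) auto
qed

lemma L_smoothD:
  assumes "L_smooth L f"
  shows "f v \<le> f w + inner (gradient f w) (v - w) + L / 2 * (norm (v - w))\<^sup>2"
  using assms by (simp add: L_smooth_def)

lemma L_smooth_mono:
  fixes f :: "'a::real_inner \<Rightarrow> real"
  assumes "L_smooth L f" and "L \<le> L'"
  shows "L_smooth L' f"
  unfolding L_smooth_def
proof (intro allI)
  fix v w :: 'a
  have "L / 2 * (norm (v - w))\<^sup>2 \<le> L' / 2 * (norm (v - w))\<^sup>2"
    using assms(2) by (intro mult_right_mono) auto
  then show "f v \<le> f w + inner (gradient f w) (v - w) + L' / 2 * (norm (v - w))\<^sup>2"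
    using L_smoothD[OF assms(1), of v w] by linarith
qed

text \<open>
  A convex function lies above its tangents, so a negative curvature bound would push it strictly
  below them at any second point.
\<close>
lemma convex_on_L_smooth_nonneg:
  fixes f :: "'a::euclidean_space \<Rightarrow> real"
  assumes "convex_on UNIV f" and "f differentiable (at 0)" and "L_smooth L f"
  shows "0 \<le> L"
proof -
  obtain b :: 'a where "b \<in> Basis"
    using nonempty_Basis by blast
  then have "norm b = 1"
    by simp
  with convex_on_above_gradient[OF assms(1,2), of b] L_smoothD[OF assms(3), of b 0]
  show ?thesis by simp
qed

text \<open>
  A gradient step of length \<open>t\<close> decreases \<open>f\<close> by at least the stated amount, and it cannot go below
  the lower bound \<open>m\<close>.
\<close>
lemma L_smooth_descent:
  assumes "L_smooth L f" and "\<And>v. m \<le> f v"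
  shows "(t - L / 2 * t\<^sup>2) * (norm (gradient f w))\<^sup>2 \<le> f w - m"
proof -
  let ?g = "gradient f w"
  have "m \<le> f (w - t *\<^sub>R ?g)"
    by (rule assms(2))
  also have "\<dots> \<le> f w + inner ?g (- (t *\<^sub>R ?g)) + L / 2 * (norm (- (t *\<^sub>R ?g)))\<^sup>2"
    using L_smoothD[OF assms(1), of "w - t *\<^sub>R ?g" w] by simp
  also have "\<dots> = f w - (t - L / 2 * t\<^sup>2) * (norm ?g)\<^sup>2"
    by (simp add: power_mult_distrib algebra_simps flip: power2_norm_eq_inner)
  finally show ?thesis by simp
qed

text \<open>The best step length in the descent inequality is \<open>1 / L\<close>.\<close>
lemma L_smooth_norm_gradient_le:
  assumes "L_smooth L f" and "0 < L" and "\<And>v. m \<le> f v"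
  shows "(norm (gradient f w))\<^sup>2 \<le> 2 * L * (f w - m)"
proof -
  have "1 / L - L / 2 * (1 / L)\<^sup>2 = 1 / (2 * L)"
    using assms(2) by (simp add: field_simps power2_eq_square)
  with L_smooth_descent[OF assms(1,3), of "1 / L" w]
  have "1 / (2 * L) * (norm (gradient f w))\<^sup>2 \<le> f w - m"
    by simp
  with assms(2) show ?thesis
    by (simp add: field_simps)
qed

text \<open>
  Without curvature, every step along a nonzero gradient decreases \<open>f\<close> in proportion to its length;
  a lower bound therefore forces the gradient to vanish, and smoothness bounds each value by each
  other one.
\<close>
lemma L_smooth_0_const:
  assumes "L_smooth 0 f" and "\<And>v. m \<le> f v"
  shows "f v = f w"
proof -
  have grad0: "gradient f u = 0" for u
  proof (rule ccontr)
    assume nz: "gradient f u \<noteq> 0"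
    define t where "t = (f u - m + 1) / (norm (gradient f u))\<^sup>2"
    from nz have "t * (norm (gradient f u))\<^sup>2 = f u - m + 1"
      by (simp add: t_def)
    moreover have "t * (norm (gradient f u))\<^sup>2 \<le> f u - m"
      using L_smooth_descent[OF assms, of t u] by simp
    ultimately show False by simp
  qed
  show ?thesis
    using L_smoothD[OF assms(1), of v w] L_smoothD[OF assms(1), of w v] by (simp add: grad0)
qed

section \<open>One step of stochastic gradient descent\<close>

text \<open>
  Expanding the square of the new distance produces an inner product and a squared gradient norm.
  Convexity bounds the former by \<open>g w - g u\<close>, smoothness the latter by a multiple of \<open>g w - m\<close>;
  splitting \<open>g w - m = (g w - g u) + (g u - m)\<close> isolates the noise \<open>g u - m\<close>.
\<close>
lemma gradient_step_distance:
  fixes g :: "'a::euclidean_space \<Rightarrow> real"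
  assumes "convex_on UNIV g" and "g differentiable (at w)" and "L_smooth L g"
    and "0 < L" and "\<And>v. m \<le> g v" and "0 \<le> a"
  shows "a * (2 - a) * (g w - g u)
       \<le> 2 * L * (norm (w - u))\<^sup>2
         - 2 * L * (norm (w - (1 / (2 * L) * a) *\<^sub>R gradient g w - u))\<^sup>2
         + a\<^sup>2 * (g u - m)"
proof -
  define G where "G = gradient g w"
  define e where "e = 1 / (2 * L) * a"
  have e: "2 * L * e = a" "4 * L * e = 2 * a" "2 * L * e\<^sup>2 = a\<^sup>2 / (2 * L)"
    using \<open>0 < L\<close> by (simp_all add: e_def power2_eq_square field_simps)
  have "(norm (w - e *\<^sub>R G - u))\<^sup>2
      = (norm (w - u))\<^sup>2 - 2 * e * inner G (w - u) + e\<^sup>2 * (norm G)\<^sup>2"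
    unfolding power2_norm_eq_inner by (simp add: algebra_simps inner_commute power2_eq_square)
  then have "2 * L * (norm (w - e *\<^sub>R G - u))\<^sup>2
      = 2 * L * ((norm (w - u))\<^sup>2 - 2 * e * inner G (w - u) + e\<^sup>2 * (norm G)\<^sup>2)"
    by simp
  also have "\<dots>
      = 2 * L * (norm (w - u))\<^sup>2 - (4 * L * e) * inner G (w - u) + (2 * L * e\<^sup>2) * (norm G)\<^sup>2"
    by (simp add: right_diff_distrib distrib_left)
  finally have expand: "2 * L * (norm (w - e *\<^sub>R G - u))\<^sup>2
      = 2 * L * (norm (w - u))\<^sup>2 - 2 * a * inner G (w - u) + a\<^sup>2 / (2 * L) * (norm G)\<^sup>2"
    unfolding e .
  have "g w - g u \<le> inner G (w - u)"
    using convex_on_above_gradient[OF assms(1,2), of u] by (simp add: G_def inner_diff_right)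
  then have convex: "2 * a * (g w - g u) \<le> 2 * a * inner G (w - u)"
    using \<open>0 \<le> a\<close> by (intro mult_left_mono) auto
  have "a\<^sup>2 / (2 * L) * (norm G)\<^sup>2 \<le> a\<^sup>2 / (2 * L) * (2 * L * (g w - m))"
    using L_smooth_norm_gradient_le[OF assms(3,4,5)] \<open>0 < L\<close>
    by (intro mult_left_mono) (auto simp: G_def)
  also have "\<dots> = a\<^sup>2 * (g w - m)"
    using \<open>0 < L\<close> by simp
  finally have "a * (2 - a) * (g w - g u)
      \<le> 2 * L * (norm (w - u))\<^sup>2 - 2 * L * (norm (w - e *\<^sub>R G - u))\<^sup>2 + a\<^sup>2 * (g u - m)"
    using expand convex by (simp add: algebra_simps power2_eq_square)
  then show ?thesis
    by (simp add: e_def G_def)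
qed

text \<open>The iterate numbered \<open>k\<close> has been computed from the indices drawn before iteration \<open>k\<close>.\<close>
lemma sgd_restrict:
  assumes "{1..<k} \<subseteq> J"
  shows "sgd fi \<eta> (restrict idx J) w1 k = sgd fi \<eta> idx w1 k"
  using assms
proof (induction k)
  case (Suc k)
  then have "{1..<k} \<subseteq> J" and "k \<noteq> 0 \<Longrightarrow> k \<in> J"
    by auto
  then show ?case
    using Suc.IH by auto
qed simp

section \<open>Expectations over independent uniform indices\<close>

locale uniform_indices = prob_space M for M :: "'m measure" +
  fixes I :: "nat \<Rightarrow> 'm \<Rightarrow> nat" and n T :: nat
  assumes n_pos: "1 \<le> n"
    and iid: "iid_uniform_indices M I n T"
begin

lemma index_measurable: "k \<in> {1..T} \<Longrightarrow> I k \<in> measurable M (count_space UNIV)"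
  using iid by (auto simp: iid_uniform_indices_def indep_vars_def)

lemma distr_index:
  "k \<in> {1..T} \<Longrightarrow> distr M (count_space UNIV) (I k) = measure_pmf (pmf_of_set {1..n})"
  using iid by (auto simp: iid_uniform_indices_def)

lemma AE_index_range:
  assumes "k \<in> {1..T}"
  shows "AE \<omega> in M. I k \<omega> \<in> {1..n}"
proof -
  have "AE i in measure_pmf (pmf_of_set {1..n}). i \<in> {1..n}"
    using n_pos by (simp add: AE_measure_pmf_iff)
  then have "AE i in distr M (count_space UNIV) (I k). i \<in> {1..n}"
    by (simp only: distr_index[OF assms])
  then show ?thesis
    by (subst (asm) AE_distr_iff) (use index_measurable[OF assms] in auto)
qed

lemma expectation_index:
  fixes h :: "nat \<Rightarrow> real"
  assumes "k \<in> {1..T}"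
  shows "expectation (\<lambda>\<omega>. h (I k \<omega>)) = (\<Sum>i=1..n. h i) / real n"
proof -
  have "expectation (\<lambda>\<omega>. h (I k \<omega>)) = integral\<^sup>L (distr M (count_space UNIV) (I k)) h"
    by (rule integral_distr[symmetric]) (use index_measurable[OF assms] in auto)
  also have "\<dots> = (\<Sum>i=1..n. h i) / real n"
    using n_pos by (simp add: distr_index[OF assms] integral_pmf_of_set)
  finally show ?thesis .
qed

lemma borel_measurable_history:
  fixes h :: "(nat \<Rightarrow> nat) \<Rightarrow> real"
  assumes "finite J"
  shows "h \<in> borel_measurable (PiM J (\<lambda>_. count_space UNIV))"
  by (subst count_space_PiM_finite) (use assms in auto)

text \<open>
  Almost surely the indices in \<open>J\<close> form one of finitely many tuples, so every real function of them
  is bounded.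
\<close>
lemma integrable_history:
  fixes h :: "(nat \<Rightarrow> nat) \<Rightarrow> real"
  assumes "J \<subseteq> {1..T}"
  shows "integrable M (\<lambda>\<omega>. h (restrict (\<lambda>j. I j \<omega>) J))"
proof -
  have "finite J"
    using assms finite_subset by blast
  let ?H = "PiE J (\<lambda>_. {1..n})"
  have "finite ?H"
    using \<open>finite J\<close> by (intro finite_PiE) auto
  have "AE \<omega> in M. \<forall>j\<in>J. I j \<omega> \<in> {1..n}"
    by (intro AE_finite_allI \<open>finite J\<close> AE_index_range) (use assms in auto)
  then have "AE \<omega> in M. norm (h (restrict (\<lambda>j. I j \<omega>) J)) \<le> (\<Sum>x\<in>?H. \<bar>h x\<bar>)"
  proof eventually_elim
    case (elim \<omega>)
    then have "restrict (\<lambda>j. I j \<omega>) J \<in> ?H"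
      by auto
    from member_le_sum[OF this _ \<open>finite ?H\<close>, of "\<lambda>x. \<bar>h x\<bar>"] show ?case
      by simp
  qed
  moreover have "(\<lambda>\<omega>. restrict (\<lambda>j. I j \<omega>) J) \<in> measurable M (PiM J (\<lambda>_. count_space UNIV))"
    by (intro measurable_restrict index_measurable) (use assms in auto)
  then have "(\<lambda>\<omega>. h (restrict (\<lambda>j. I j \<omega>) J)) \<in> borel_measurable M"
    by (rule measurable_compose[OF _ borel_measurable_history[OF \<open>finite J\<close>]])
  ultimately show ?thesis
    by (rule integrable_const_bound)
qed

text \<open>
  Conditioning on the indices in \<open>J\<close>, a further index \<open>k\<close> is still uniform. The conditional
  expectation is avoided by splitting over the finitely many values of \<open>I k\<close> and factorising each
  term by independence.
\<close>
lemma expectation_fresh_index: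
  fixes h :: "nat \<Rightarrow> (nat \<Rightarrow> nat) \<Rightarrow> real"
  assumes "J \<subseteq> {1..T}" and "k \<in> {1..T}" and "k \<notin> J"
  shows "expectation (\<lambda>\<omega>. h (I k \<omega>) (restrict (\<lambda>j. I j \<omega>) J))
       = expectation (\<lambda>\<omega>. (\<Sum>i=1..n. h i (restrict (\<lambda>j. I j \<omega>) J)) / real n)"
proof -
  let ?R = "\<lambda>\<omega>. restrict (\<lambda>j. I j \<omega>) J"
  let ?S = "\<lambda>\<omega>. restrict (\<lambda>j. I j \<omega>) {k}"
  have "finite J"
    using assms(1) finite_subset by blast
  have indep: "indep_var (PiM {k} (\<lambda>_. count_space UNIV)) ?S (PiM J (\<lambda>_. count_space UNIV)) ?R"
    using iid assms by (intro indep_var_restrict[where I = "{1..T}"]) (auto simp: iid_uniform_indices_def)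
  have ind_int: "integrable M (\<lambda>\<omega>. indicator {i} (I k \<omega>) :: real)" for i
    using integrable_history[of "{k}" "\<lambda>x. indicator {i} (x k)"] assms(2) by simp
  have factor:
    "integrable M (\<lambda>\<omega>. indicator {i} (I k \<omega>) * h i (?R \<omega>))"
    "expectation (\<lambda>\<omega>. indicator {i} (I k \<omega>) * h i (?R \<omega>)) = expectation (\<lambda>\<omega>. h i (?R \<omega>)) / real n"
    if "i \<in> {1..n}" for i
  proof -
    have "indep_var borel ((\<lambda>x. indicator {i} (x k)) \<circ> ?S) borel (h i \<circ> ?R)"
      by (intro indep_var_compose[OF indep] borel_measurable_history) (use \<open>finite J\<close> in auto)
    then have ind: "indep_var borel (\<lambda>\<omega>. indicator {i} (I k \<omega>)) borel (\<lambda>\<omega>. h i (?R \<omega>))"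
      by (simp add: comp_def)
    show "integrable M (\<lambda>\<omega>. indicator {i} (I k \<omega>) * h i (?R \<omega>))"
      by (rule indep_var_integrable[OF ind ind_int integrable_history[OF assms(1)]])
    have "expectation (\<lambda>\<omega>. indicator {i} (I k \<omega>)) = (\<Sum>l=1..n. indicator {i} l) / real n"
      by (rule expectation_index[OF assms(2)])
    also have "(\<Sum>l=1..n. indicator {i} l :: real) = 1"
      using that by (simp add: indicator_def)
    finally show "expectation (\<lambda>\<omega>. indicator {i} (I k \<omega>) * h i (?R \<omega>))
        = expectation (\<lambda>\<omega>. h i (?R \<omega>)) / real n"
      unfolding indep_var_lebesgue_integral[OF ind ind_int integrable_history[OF assms(1)]]
      by (simp only: mult_1 times_divide_eq_left)
  qed
  have meas: "(\<lambda>\<omega>. h (I k \<omega>) (?R \<omega>)) \<in> borel_measurable M"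
  proof -
    have "(\<lambda>\<omega>. h (I k \<omega>) (?R \<omega>))
        = (\<lambda>\<omega>. (\<lambda>x. h (x k) (restrict x J)) (restrict (\<lambda>j. I j \<omega>) (insert k J)))"
      by (simp add: restrict_restrict Int_absorb1 subset_insertI)
    then show ?thesis
      using integrable_history[of "insert k J" "\<lambda>x. h (x k) (restrict x J)"] assms(1,2)
      by (auto dest: borel_measurable_integrable)
  qed
  have "expectation (\<lambda>\<omega>. h (I k \<omega>) (?R \<omega>))
      = expectation (\<lambda>\<omega>. \<Sum>i=1..n. indicator {i} (I k \<omega>) * h i (?R \<omega>))"
  proof (rule integral_cong_AE)
    show "AE \<omega> in M. h (I k \<omega>) (?R \<omega>) = (\<Sum>i=1..n. indicator {i} (I k \<omega>) * h i (?R \<omega>))"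
      using AE_index_range[OF assms(2)]
    proof eventually_elim
      case (elim \<omega>)
      have "(\<Sum>i=1..n. indicator {i} (I k \<omega>) * h i (?R \<omega>))
          = (\<Sum>i=1..n. if i = I k \<omega> then h i (?R \<omega>) else 0)"
        by (intro sum.cong) auto
      with elim show ?case by simp
    qed
    show "(\<lambda>\<omega>. \<Sum>i=1..n. indicator {i} (I k \<omega>) * h i (?R \<omega>)) \<in> borel_measurable M"
      by (intro borel_measurable_sum borel_measurable_integrable factor(1))
  qed (rule meas)
  also have "\<dots> = (\<Sum>i=1..n. expectation (\<lambda>\<omega>. h i (?R \<omega>)) / real n)"
    by (subst Bochner_Integration.integral_sum) (use factor in \<open>auto simp del: indicator_simps\<close>)
  also have "\<dots> = expectation (\<lambda>\<omega>. (\<Sum>i=1..n. h i (?R \<omega>)) / real n)"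
    by (simp add: integrable_history[OF assms(1)] sum_divide_distrib)
  finally show ?thesis .
qed

section \<open>Convergence for decaying step-sizes\<close>

text \<open>
  Averaging the one-step inequality over the fresh index turns the random component into \<open>f\<close>.
  Only after that is \<open>f w - f wstar\<close> nonnegative, so that the factor \<open>2 - \<alpha> k \<ge> 1\<close> may be dropped;
  the single components satisfy no such inequality.
\<close>
lemma sgd_expected_step:
  fixes fi :: "nat \<Rightarrow> 'a::euclidean_space \<Rightarrow> real"
    and w1 wstar :: 'a
  assumes diff: "\<And>i w. i \<in> {1..n} \<Longrightarrow> fi i differentiable (at w)"
    and convex: "\<And>i. i \<in> {1..n} \<Longrightarrow> convex_on UNIV (fi i)"
    and smooth: "\<And>i. i \<in> {1..n} \<Longrightarrow> L_smooth L (fi i)"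
    and lower: "\<And>i v. i \<in> {1..n} \<Longrightarrow> fi_min i \<le> fi i v"
    and min: "\<And>v. finite_sum n fi wstar \<le> finite_sum n fi v"
    and "0 < L" and k: "k \<in> {1..T}" and \<alpha>: "0 < \<alpha> k" "\<alpha> k \<le> 1"
  defines "w \<equiv> \<lambda>k \<omega>. sgd fi (\<lambda>k. 1 / (2 * L) * \<alpha> k) (\<lambda>k. I k \<omega>) w1 k"
  shows "\<alpha> k * expectation (\<lambda>\<omega>. finite_sum n fi (w k \<omega>) - finite_sum n fi wstar)
       \<le> 2 * L * expectation (\<lambda>\<omega>. (norm (w k \<omega> - wstar))\<^sup>2)
         - 2 * L * expectation (\<lambda>\<omega>. (norm (w (Suc k) \<omega> - wstar))\<^sup>2)
         + (\<alpha> k)\<^sup>2 * ((\<Sum>i=1..n. fi i wstar - fi_min i) / real n)"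
proof -
  define J where "J = {1..<k}"
  have J: "J \<subseteq> {1..T}" "k \<notin> J"
    using k by (auto simp: J_def)
  define W where "W x = sgd fi (\<lambda>k. 1 / (2 * L) * \<alpha> k) x w1 k" for x
  let ?R = "\<lambda>\<omega>. restrict (\<lambda>j. I j \<omega>) J"
  have w_k: "w k \<omega> = W (?R \<omega>)" for \<omega>
    unfolding w_def W_def by (rule sgd_restrict[symmetric]) (simp add: J_def)
  define D where "D i x = (norm (x - (1 / (2 * L) * \<alpha> k) *\<^sub>R gradient (fi i) x - wstar))\<^sup>2" for i x
  have w_Suc: "(norm (w (Suc k) \<omega> - wstar))\<^sup>2 = D (I k \<omega>) (W (?R \<omega>))" for \<omega>
    using k by (simp add: w_k[symmetric] D_def) (simp add: w_def)
  have f_diff: "finite_sum n fi x - finite_sum n fi y = (\<Sum>i=1..n. fi i x - fi i y) / real n" for x y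
    by (simp add: finite_sum_def sum_subtractf diff_divide_distrib)
  have int: "integrable M (\<lambda>\<omega>. h (W (?R \<omega>)))" for h :: "'a \<Rightarrow> real"
    using integrable_history[OF J(1), of "\<lambda>x. h (W x)"] .

  let ?\<sigma> = "(\<Sum>i=1..n. fi i wstar - fi_min i) / real n"
  let ?\<Delta> = "\<lambda>x. finite_sum n fi x - finite_sum n fi wstar"
  have step: "\<alpha> k * ?\<Delta> x
      \<le> 2 * L * (norm (x - wstar))\<^sup>2 - 2 * L * ((\<Sum>i=1..n. D i x) / real n) + (\<alpha> k)\<^sup>2 * ?\<sigma>" for x
  proof -
    have "\<alpha> k * ?\<Delta> x \<le> \<alpha> k * (2 - \<alpha> k) * ?\<Delta> x"
      using \<alpha> min[of x] by (intro mult_right_mono) auto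
    also have "\<dots> = (\<Sum>i=1..n. \<alpha> k * (2 - \<alpha> k) * (fi i x - fi i wstar)) / real n"
      by (simp add: f_diff sum_distrib_left)
    also have "\<dots> \<le> (\<Sum>i=1..n. 2 * L * (norm (x - wstar))\<^sup>2 - 2 * L * D i x
                       + (\<alpha> k)\<^sup>2 * (fi i wstar - fi_min i)) / real n"
      unfolding D_def using \<alpha> \<open>0 < L\<close>
      by (intro divide_right_mono sum_mono gradient_step_distance)
         (auto intro: diff convex smooth lower)
    also have "\<dots> = 2 * L * (norm (x - wstar))\<^sup>2 - 2 * L * ((\<Sum>i=1..n. D i x) / real n)
                      + (\<alpha> k)\<^sup>2 * ?\<sigma>"
      unfolding sum.distrib sum_subtractf[of "\<lambda>_. 2 * L * (norm (x - wstar))\<^sup>2"]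
        sum_distrib_left[symmetric]
      using n_pos by (simp add: add_divide_distrib diff_divide_distrib)
    finally show ?thesis .
  qed
  have "\<alpha> k * expectation (\<lambda>\<omega>. ?\<Delta> (w k \<omega>)) = expectation (\<lambda>\<omega>. \<alpha> k * ?\<Delta> (W (?R \<omega>)))"
    by (simp add: w_k)
  also have "\<dots> \<le> expectation (\<lambda>\<omega>. 2 * L * (norm (W (?R \<omega>) - wstar))\<^sup>2
                    - 2 * L * ((\<Sum>i=1..n. D i (W (?R \<omega>))) / real n) + (\<alpha> k)\<^sup>2 * ?\<sigma>)"
    by (intro integral_mono step int)
  also have "\<dots> = 2 * L * expectation (\<lambda>\<omega>. (norm (W (?R \<omega>) - wstar))\<^sup>2)
      - 2 * L * expectation (\<lambda>\<omega>. (\<Sum>i=1..n. D i (W (?R \<omega>))) / real n) + (\<alpha> k)\<^sup>2 * ?\<sigma>"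
  proof -
    have lin: "expectation (\<lambda>\<omega>. p * A \<omega> - p * B \<omega> + c) = p * expectation A - p * expectation B + c"
      if "integrable M A" and "integrable M B" for A B and p c :: real
      using that by (simp add: prob_space)
    show ?thesis
      by (intro lin int[of "\<lambda>x. (norm (x - wstar))\<^sup>2"] int[of "\<lambda>x. (\<Sum>i=1..n. D i x) / real n"])
  qed
  also have "expectation (\<lambda>\<omega>. (\<Sum>i=1..n. D i (W (?R \<omega>))) / real n)
      = expectation (\<lambda>\<omega>. D (I k \<omega>) (W (?R \<omega>)))"
    using expectation_fresh_index[OF J(1) k J(2), of "\<lambda>i x. D i (W x)"] by simp
  finally show ?thesis
    by (simp only: w_k w_Suc)
qed

text \<open>
  Summed over the iterations the expected squared distances telescope, and by Jensen's inequality
  the weighted average is at least as good as the weighted mean of the single suboptimalities.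
\<close>
lemma sgd_weighted_average_rate_pos:
  fixes fi :: "nat \<Rightarrow> 'a::euclidean_space \<Rightarrow> real"
    and w1 wstar :: 'a
  assumes diff: "\<And>i w. i \<in> {1..n} \<Longrightarrow> fi i differentiable (at w)"
    and convex: "\<And>i. i \<in> {1..n} \<Longrightarrow> convex_on UNIV (fi i)"
    and smooth: "\<And>i. i \<in> {1..n} \<Longrightarrow> L_smooth L (fi i)"
    and lower: "\<And>i v. i \<in> {1..n} \<Longrightarrow> fi_min i \<le> fi i v"
    and min: "\<And>v. finite_sum n fi wstar \<le> finite_sum n fi v"
    and "0 < L" and "1 \<le> T" and \<alpha>: "\<And>k. k \<in> {1..T} \<Longrightarrow> 0 < \<alpha> k \<and> \<alpha> k \<le> 1"
  defines "w \<equiv> \<lambda>\<omega>. sgd fi (\<lambda>k. 1 / (2 * L) * \<alpha> k) (\<lambda>k. I k \<omega>) w1"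
  shows "expectation (\<lambda>\<omega>. finite_sum n fi (weighted_average \<alpha> (w \<omega>) T) - finite_sum n fi wstar)
       \<le> 2 * L * (norm (w1 - wstar))\<^sup>2 / (\<Sum>k=1..T. \<alpha> k)
         + (\<Sum>i=1..n. fi i wstar - fi_min i) / real n
           * ((\<Sum>k=1..T. (\<alpha> k)\<^sup>2) / (\<Sum>k=1..T. \<alpha> k))"
proof -
  define S where "S = (\<Sum>k=1..T. \<alpha> k)"
  have "0 < S"
    unfolding S_def using \<open>1 \<le> T\<close> \<alpha> by (intro sum_pos) auto
  let ?f = "finite_sum n fi"
  let ?\<sigma> = "(\<Sum>i=1..n. fi i wstar - fi_min i) / real n"
  let ?\<Delta> = "\<lambda>k \<omega>. ?f (w \<omega> k) - ?f wstar"
  let ?d = "\<lambda>k. 2 * L * expectation (\<lambda>\<omega>. (norm (w \<omega> k - wstar))\<^sup>2)"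
  have w_int: "integrable M (\<lambda>\<omega>. h (w \<omega> k))" if "k \<in> {1..T}" for h :: "'a \<Rightarrow> real" and k
  proof -
    have "{1..<k} \<subseteq> {1..T}"
      using that by auto
    from integrable_history[OF this, of "\<lambda>x. h (sgd fi (\<lambda>k. 1 / (2 * L) * \<alpha> k) x w1 k)"]
    show ?thesis
      by (simp add: w_def sgd_restrict)
  qed
  have avg_int: "integrable M (\<lambda>\<omega>. h (weighted_average \<alpha> (w \<omega>) T))" for h :: "'a \<Rightarrow> real"
  proof -
    have "weighted_average \<alpha> (w \<omega>) T = weighted_average \<alpha>
        (sgd fi (\<lambda>k. 1 / (2 * L) * \<alpha> k) (restrict (\<lambda>j. I j \<omega>) {1..T}) w1) T" for \<omega>
      unfolding weighted_average_def w_def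
      by (intro arg_cong2[where f = scaleR] sum.cong refl sgd_restrict[symmetric]) auto
    then show ?thesis
      using integrable_history[of "{1..T}"
          "\<lambda>x. h (weighted_average \<alpha> (sgd fi (\<lambda>k. 1 / (2 * L) * \<alpha> k) x w1) T)"]
      by simp
  qed

  have "(\<Sum>k=1..T. \<alpha> k * expectation (?\<Delta> k))
      \<le> (\<Sum>k=1..T. ?d k - ?d (Suc k) + (\<alpha> k)\<^sup>2 * ?\<sigma>)"
    unfolding w_def
    by (intro sum_mono sgd_expected_step)
       (use \<alpha> \<open>0 < L\<close> in \<open>auto intro: diff convex smooth lower min\<close>)
  also have "\<dots> = (?d 1 - ?d (Suc T)) + (\<Sum>k=1..T. (\<alpha> k)\<^sup>2) * ?\<sigma>"
  proof -
    have "(\<Sum>k=1..T. ?d k - ?d (Suc k)) = ?d 1 - ?d (Suc T)"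
      using sum_Suc_diff[of 1 T "\<lambda>k. - ?d k"] \<open>1 \<le> T\<close> by simp
    then show ?thesis
      by (simp only: sum.distrib sum_distrib_right)
  qed
  also have "\<dots> \<le> 2 * L * (norm (w1 - wstar))\<^sup>2 + (\<Sum>k=1..T. (\<alpha> k)\<^sup>2) * ?\<sigma>"
  proof -
    have "?d 1 = 2 * L * (norm (w1 - wstar))\<^sup>2"
      by (simp add: w_def prob_space)
    moreover have "0 \<le> ?d (Suc T)"
      using \<open>0 < L\<close> by simp
    ultimately show ?thesis by linarith
  qed
  finally have sum_bound: "(\<Sum>k=1..T. \<alpha> k * expectation (?\<Delta> k))
      \<le> 2 * L * (norm (w1 - wstar))\<^sup>2 + (\<Sum>k=1..T. (\<alpha> k)\<^sup>2) * ?\<sigma>" .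

  have jensen: "?f (weighted_average \<alpha> x T) - ?f wstar \<le> (\<Sum>k=1..T. \<alpha> k / S * (?f (x k) - ?f wstar))" for x
  proof -
    have weights: "(\<Sum>k=1..T. \<alpha> k / S) = 1"
      using \<open>0 < S\<close> by (simp add: S_def flip: sum_divide_distrib)
    have f_convex: "convex_on UNIV ?f"
      by (intro convex_on_finite_sum convex)
    have "weighted_average \<alpha> x T = (\<Sum>k=1..T. (\<alpha> k / S) *\<^sub>R x k)"
      by (simp add: weighted_average_def S_def scaleR_sum_right divide_inverse mult.commute)
    also have "?f \<dots> \<le> (\<Sum>k=1..T. \<alpha> k / S * ?f (x k))"
      using weights \<open>1 \<le> T\<close> \<alpha> \<open>0 < S\<close>
      by (intro convex_on_sum[OF _ _ f_convex]) (auto intro: less_imp_le)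
    also have "\<dots> = (\<Sum>k=1..T. \<alpha> k / S * (?f (x k) - ?f wstar)) + ?f wstar"
      unfolding right_diff_distrib sum_subtractf sum_distrib_right[symmetric] weights by simp
    finally show ?thesis by simp
  qed
  have "expectation (\<lambda>\<omega>. ?f (weighted_average \<alpha> (w \<omega>) T) - ?f wstar)
      \<le> expectation (\<lambda>\<omega>. \<Sum>k=1..T. \<alpha> k / S * ?\<Delta> k \<omega>)"
    by (intro integral_mono jensen avg_int Bochner_Integration.integrable_sum w_int)
  also have "\<dots> = (\<Sum>k=1..T. \<alpha> k / S * expectation (?\<Delta> k))"
    using w_int[of _ "\<lambda>x. ?f x - ?f wstar"] by (subst Bochner_Integration.integral_sum) auto
  also have "\<dots> = (\<Sum>k=1..T. \<alpha> k * expectation (?\<Delta> k)) / S"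
    by (simp add: sum_divide_distrib)
  also have "\<dots> \<le> (2 * L * (norm (w1 - wstar))\<^sup>2 + (\<Sum>k=1..T. (\<alpha> k)\<^sup>2) * ?\<sigma>) / S"
    using sum_bound \<open>0 < S\<close> by (intro divide_right_mono) auto
  finally show ?thesis
    by (simp add: S_def add_divide_distrib mult.commute)
qed

text \<open>
  For \<open>L = 0\<close> the step-size is a quotient by zero, hence \<open>0\<close>; but then all components are constant, so
  the left-hand side vanishes.
\<close>
lemma sgd_weighted_average_rate:
  fixes fi :: "nat \<Rightarrow> 'a::euclidean_space \<Rightarrow> real"
    and w1 wstar :: 'a
  assumes diff: "\<And>i w. i \<in> {1..n} \<Longrightarrow> fi i differentiable (at w)"
    and convex: "\<And>i. i \<in> {1..n} \<Longrightarrow> convex_on UNIV (fi i)"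
    and smooth: "\<And>i. i \<in> {1..n} \<Longrightarrow> L_smooth L (fi i)"
    and lower: "\<And>i v. i \<in> {1..n} \<Longrightarrow> fi_min i \<le> fi i v"
    and min: "\<And>v. finite_sum n fi wstar \<le> finite_sum n fi v"
    and "1 \<le> T" and \<alpha>: "\<And>k. k \<in> {1..T} \<Longrightarrow> 0 < \<alpha> k \<and> \<alpha> k \<le> 1"
  defines "w \<equiv> \<lambda>\<omega>. sgd fi (\<lambda>k. 1 / (2 * L) * \<alpha> k) (\<lambda>k. I k \<omega>) w1"
  shows "expectation (\<lambda>\<omega>. finite_sum n fi (weighted_average \<alpha> (w \<omega>) T) - finite_sum n fi wstar)
       \<le> 2 * L * (norm (w1 - wstar))\<^sup>2 / (\<Sum>k=1..T. \<alpha> k)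
         + (\<Sum>i=1..n. fi i wstar - fi_min i) / real n
           * ((\<Sum>k=1..T. (\<alpha> k)\<^sup>2) / (\<Sum>k=1..T. \<alpha> k))"
proof -
  have "1 \<in> {1..n}"
    using n_pos by simp
  then have "0 \<le> L"
    using convex_on_L_smooth_nonneg[OF convex diff smooth] by blast
  then consider "L = 0" | "0 < L"
    by linarith
  then show ?thesis
  proof cases
    case 1
    have "fi i v = fi i wstar" if "i \<in> {1..n}" for i v
      using smooth[OF that] lower[OF that] unfolding 1 by (rule L_smooth_0_const)
    then have "finite_sum n fi v = finite_sum n fi wstar" for v
      unfolding finite_sum_def by (intro arg_cong2[where f = "(*)"] sum.cong refl)
    then have const: "finite_sum n fi v - finite_sum n fi wstar = 0" for v
      by (rule eq_iff_diff_eq_0[THEN iffD1])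
    have "0 \<le> (\<Sum>i=1..n. fi i wstar - fi_min i)" "0 \<le> (\<Sum>k=1..T. \<alpha> k)"
      using lower \<alpha> by (auto intro!: sum_nonneg intro: less_imp_le)
    then show ?thesis
      unfolding const using 1 by (auto intro!: mult_nonneg_nonneg divide_nonneg_nonneg sum_nonneg)
  next
    case 2
    then show ?thesis
      unfolding w_def using assms by (intro sgd_weighted_average_rate_pos) auto
  qed
qed

end

section \<open>Exponentially decaying step-sizes\<close>

text \<open>
  The weights are the powers \<open>a ^ k\<close>, whose sum is \<open>(a - a * (\<beta> / T)) / (1 - a)\<close> because
  \<open>a ^ T = \<beta> / T\<close>. The denominator is at most \<open>- ln a = ln (T / \<beta>) / T\<close>.
\<close>
lemma exponential_weights:
  fixes \<beta> a :: real and \<alpha> :: "nat \<Rightarrow> real"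
  assumes "1 \<le> T" and "1 \<le> \<beta>" and a: "a = (\<beta> / real T) powr (1 / real T)"
    and gap: "2 * \<beta> < a * real T"
    and \<alpha>: "\<And>k. \<alpha> k = (\<beta> / real T) powr (real k / real T)"
  shows "\<beta> < real T"
    and "\<And>k. 0 < \<alpha> k \<and> \<alpha> k \<le> 1"
    and "1 / (\<Sum>k=1..T. \<alpha> k) \<le> ln (real T / \<beta>) / (a * real T - 2 * \<beta>)"
proof -
  have T: "1 \<le> real T"
    using \<open>1 \<le> T\<close> by simp
  show less: "\<beta> < real T"
  proof (rule ccontr)
    assume "\<not> \<beta> < real T"
    then have "1 \<le> \<beta> / real T"
      using T by simp
    then have "a \<le> (\<beta> / real T) powr 1"
      unfolding a using T by (intro powr_mono) auto
    then have "a * real T \<le> \<beta>"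
      using T \<open>1 \<le> \<beta>\<close> by (simp add: field_simps)
    with gap \<open>1 \<le> \<beta>\<close> show False by linarith
  qed
  show "0 < \<alpha> k \<and> \<alpha> k \<le> 1" for k
    unfolding \<alpha> using less \<open>1 \<le> \<beta>\<close> T by (auto intro!: powr_le1)
  have "0 < a"
    unfolding a using \<open>1 \<le> \<beta>\<close> T by simp
  have \<alpha>_power: "\<alpha> k = a ^ k" for k
  proof -
    have "a ^ k = a powr real k"
      using \<open>0 < a\<close> by (simp add: powr_realpow)
    also have "\<dots> = (\<beta> / real T) powr (real k / real T)"
      unfolding a by (simp add: powr_powr)
    finally show ?thesis
      by (simp add: \<alpha>)
  qed
  have a_T: "a ^ T = \<beta> / real T"
    using \<alpha>[of T] \<open>1 \<le> \<beta>\<close> T by (simp add: \<alpha>_power)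
  have ln_a: "ln (real T / \<beta>) = - ln a * real T"
    unfolding a using \<open>1 \<le> \<beta>\<close> T by (simp add: ln_powr ln_div)
  have "0 < ln (real T / \<beta>)"
    using less \<open>1 \<le> \<beta>\<close> by simp
  then have "0 < - ln a"
    unfolding ln_a using T by (simp add: zero_less_mult_iff mult_less_0_iff)
  then have "a < 1"
    using \<open>0 < a\<close> by (simp add: ln_less_zero_iff)
  let ?S = "\<Sum>k=1..T. \<alpha> k"
  have "?S * (1 - a) = a - a * a ^ T"
  proof -
    have "(1 - a) * (\<Sum>k=1..T. a ^ k) = a ^ 1 - a ^ Suc T"
      using sum_gp_multiplied[of 1 T a] \<open>1 \<le> T\<close> by simp
    then show ?thesis
      by (simp add: \<alpha>_power mult.commute)
  qed
  then have S_eq: "?S * (1 - a) * real T = a * real T - a * \<beta>"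
    using T by (simp add: a_T field_simps)
  have "0 < ?S"
    using \<open>1 \<le> T\<close> \<open>0 < a\<close> by (intro sum_pos) (auto simp: \<alpha>_power)
  have "a * \<beta> \<le> 2 * \<beta>"
    using \<open>a < 1\<close> \<open>1 \<le> \<beta>\<close> by (intro mult_right_mono) auto
  then have "a * real T - 2 * \<beta> \<le> ?S * (1 - a) * real T"
    using S_eq by linarith
  also have "\<dots> \<le> ?S * (- ln a) * real T"
    using ln_le_minus_one[OF \<open>0 < a\<close>] \<open>0 < ?S\<close> by (intro mult_right_mono mult_left_mono) auto
  also have "\<dots> = ?S * ln (real T / \<beta>)"
    by (simp add: ln_a)
  finally show "1 / ?S \<le> ln (real T / \<beta>) / (a * real T - 2 * \<beta>)"
    using \<open>0 < ?S\<close> gap by (simp add: field_simps)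
qed

theorem theorem8:
  fixes fi :: "nat \<Rightarrow> real ^ 'd \<Rightarrow> real"
    and f :: "real ^ 'd \<Rightarrow> real"
    and n T :: nat
    and Li fi_min :: "nat \<Rightarrow> real"
    and L \<sigma>2 :: real
    and w1 wstar :: "real ^ 'd"
    and M :: "'m measure"
    and I :: "nat \<Rightarrow> 'm \<Rightarrow> nat"
  assumes "n \<ge> 1" and "T \<ge> 1"
    and "f = finite_sum n fi"
    and "\<And>i w. i \<in> {1..n} \<Longrightarrow> fi i differentiable (at w)"
    and "\<And>i. i \<in> {1..n} \<Longrightarrow> is_minimum_value (fi i) (fi_min i)"
    and "\<And>i. i \<in> {1..n} \<Longrightarrow> convex_on UNIV (fi i)"
    and "\<And>i. i \<in> {1..n} \<Longrightarrow> L_smooth (Li i) (fi i)"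
    and "L = Max (Li ` {1..n})"
    and "is_arg_min f (\<lambda>_. True) wstar"
    and "\<sigma>2 = measure_pmf.expectation (pmf_of_set {1..n}) (\<lambda>i. fi i wstar - fi_min i)"
    and "prob_space M"
    and "iid_uniform_indices M I n T"
  shows
    "(\<forall>\<alpha> :: nat \<Rightarrow> real.
        (\<forall>k\<in>{1..T}. 0 < \<alpha> k \<and> \<alpha> k \<le> 1) \<longrightarrow>
        prob_space.expectation M
          (\<lambda>\<omega>. f (weighted_average \<alpha> (sgd fi (\<lambda>k. 1 / (2 * L) * \<alpha> k) (\<lambda>k. I k \<omega>) w1) T) - f wstar)
        \<le> 2 * L * (norm (w1 - wstar))\<^sup>2 / (\<Sum>k=1..T. \<alpha> k)
          + \<sigma>2 * ((\<Sum>k=1..T. (\<alpha> k)\<^sup>2) / (\<Sum>k=1..T. \<alpha> k)))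
     \<and>
     (\<forall>\<beta> :: real. \<forall>a :: real. \<forall>\<alpha> :: nat \<Rightarrow> real.
        1 \<le> \<beta> \<and> a = (\<beta> / real T) powr (1 / real T) \<and> 2 * \<beta> < a * real T \<and>
        (\<forall>k. \<alpha> k = (\<beta> / real T) powr (real k / real T)) \<longrightarrow>
        prob_space.expectation M
          (\<lambda>\<omega>. f (weighted_average \<alpha> (sgd fi (\<lambda>k. 1 / (2 * L) * \<alpha> k) (\<lambda>k. I k \<omega>) w1) T) - f wstar)
        \<le> 2 * L * ln (real T / \<beta>) * (norm (w1 - wstar))\<^sup>2 / (a * real T - 2 * \<beta>)
          + \<sigma>2 * (real T / (real T - \<beta>)))"
proof -
  interpret uniform_indices M I n T
    using assms(1,11,12) by (simp add: uniform_indices_def uniform_indices_axioms_def)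
  have lower: "fi_min i \<le> fi i v" if "i \<in> {1..n}" for i v
    using assms(5)[OF that] by (auto simp: is_minimum_value_def is_arg_min_def not_less)
  have min: "finite_sum n fi wstar \<le> finite_sum n fi v" for v
    using assms(9) by (auto simp: assms(3) is_arg_min_def not_less)
  have smooth: "L_smooth L (fi i)" if "i \<in> {1..n}" for i
    using assms(7)[OF that] by (rule L_smooth_mono) (use that in \<open>auto simp: assms(8)\<close>)
  have \<sigma>2: "\<sigma>2 = (\<Sum>i=1..n. fi i wstar - fi_min i) / real n"
    using \<open>n \<ge> 1\<close> by (simp add: assms(10) integral_pmf_of_set)
  have "0 \<le> \<sigma>2"
    unfolding \<sigma>2 using lower by (intro divide_nonneg_nonneg sum_nonneg) auto
  have "1 \<in> {1..n}"
    using \<open>n \<ge> 1\<close> by simp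
  then have "0 \<le> L"
    using convex_on_L_smooth_nonneg[OF assms(6,4) smooth] by blast

  let ?gap = "\<lambda>\<alpha>. expectation (\<lambda>\<omega>. f (weighted_average \<alpha>
      (sgd fi (\<lambda>k. 1 / (2 * L) * \<alpha> k) (\<lambda>k. I k \<omega>) w1) T) - f wstar)"
  have rate: "?gap \<alpha> \<le> 2 * L * (norm (w1 - wstar))\<^sup>2 / (\<Sum>k=1..T. \<alpha> k)
      + \<sigma>2 * ((\<Sum>k=1..T. (\<alpha> k)\<^sup>2) / (\<Sum>k=1..T. \<alpha> k))"
    if "\<forall>k\<in>{1..T}. 0 < \<alpha> k \<and> \<alpha> k \<le> 1" for \<alpha>
    unfolding assms(3) \<sigma>2
    by (rule sgd_weighted_average_rate) (use assms(2,4,6) smooth lower min that in auto)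

  have "?gap \<alpha> \<le> 2 * L * ln (real T / \<beta>) * (norm (w1 - wstar))\<^sup>2 / (a * real T - 2 * \<beta>)
      + \<sigma>2 * (real T / (real T - \<beta>))"
    if "1 \<le> \<beta>" and "a = (\<beta> / real T) powr (1 / real T)" and "2 * \<beta> < a * real T"
      and "\<And>k. \<alpha> k = (\<beta> / real T) powr (real k / real T)" for \<alpha> \<beta> a
  proof -
    note weights = exponential_weights[OF \<open>T \<ge> 1\<close> that]
    let ?S = "\<Sum>k=1..T. \<alpha> k"
    have "0 < ?S"
      using \<open>T \<ge> 1\<close> weights(2) by (intro sum_pos) auto
    have "2 * L * (norm (w1 - wstar))\<^sup>2 / ?S
        \<le> 2 * L * ln (real T / \<beta>) * (norm (w1 - wstar))\<^sup>2 / (a * real T - 2 * \<beta>)"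
      using mult_left_mono[OF weights(3), of "2 * L * (norm (w1 - wstar))\<^sup>2"] \<open>0 \<le> L\<close>
      by (simp add: mult.assoc mult.left_commute mult.commute)
    moreover have "(\<Sum>k=1..T. (\<alpha> k)\<^sup>2) / ?S \<le> real T / (real T - \<beta>)"
    proof -
      have "(\<alpha> k)\<^sup>2 \<le> \<alpha> k" for k
        using weights(2)[of k] by (simp add: power2_eq_square mult_left_le)
      then have "(\<Sum>k=1..T. (\<alpha> k)\<^sup>2) / ?S \<le> 1"
        using \<open>0 < ?S\<close> by (simp add: sum_mono)
      also have "1 \<le> real T / (real T - \<beta>)"
        using weights(1) \<open>1 \<le> \<beta>\<close> by simp
      finally show ?thesis .
    qed
    then have "\<sigma>2 * ((\<Sum>k=1..T. (\<alpha> k)\<^sup>2) / ?S) \<le> \<sigma>2 * (real T / (real T - \<beta>))"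
      using \<open>0 \<le> \<sigma>2\<close> by (rule mult_left_mono)
    moreover have "\<forall>k\<in>{1..T}. 0 < \<alpha> k \<and> \<alpha> k \<le> 1"
      using weights(2) by blast
    ultimately show ?thesis
      using rate[of \<alpha>] by linarith
  qed
  with rate show ?thesis
    by blast
qed

end
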